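(* (i) If $\mathcal{H}$ is a 3-uniform hypergraph on $n$ vertices without isolated vertices, then $\gamma_g(\mathcal{H})\le \frac{5}{9}n$. (ii) If $G$ is a graph of order $n$ without isolated vertices in which every edge belongs to a triangle, then $\gamma_g(G)\le \frac{5}{9}n$.
   Context: Hypergraphs and graphs are finite. In a hypergraph (or graph), two distinct vertices are adjacent if some edge contains both; $N[v]$ is $v$ together with all vertices adjacent to $v$, and $N[S]=\bigcup_{v\in S}N[v]$. The domination game: Dominator and Staller alternately choose vertices $v_1,v_2,\dots$; with $D_i=\{v_1,\dots,v_i\}$, each chosen vertex must satisfy $N[v_i]\setminus N[D_{i-1}]\ne\emptyset$, and the game ends when $N[D_d]$ is the whole vertex set. Dominator aims to minimize the number of moves, Staller to maximize it. $\gamma_g$ denotes the number of moves under optimal play when Dominator makes the first move. *)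

theory Defs
  imports Complex_Main
begin

definition hypergraph :: "'a set \<Rightarrow> 'a set set \<Rightarrow> bool" where
  "hypergraph V E \<longleftrightarrow> finite V \<and> (\<forall>e\<in>E. e \<subseteq> V)"

definition uniform :: "nat \<Rightarrow> 'a set set \<Rightarrow> bool" where
  "uniform k E \<longleftrightarrow> (\<forall>e\<in>E. card e = k)"

definition simple_graph :: "'a set \<Rightarrow> 'a set set \<Rightarrow> bool" where
  "simple_graph V E \<longleftrightarrow> hypergraph V E \<and> uniform 2 E"

definition adjacent :: "'a set set \<Rightarrow> 'a \<Rightarrow> 'a \<Rightarrow> bool" where
  "adjacent E u v \<longleftrightarrow> u \<noteq> v \<and> (\<exists>e\<in>E. u \<in> e \<and> v \<in> e)"

definition closed_nbhd :: "'a set set \<Rightarrow> 'a \<Rightarrow> 'a set" where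
  "closed_nbhd E v = insert v {u. adjacent E v u}"

definition no_isolated :: "'a set \<Rightarrow> 'a set set \<Rightarrow> bool" where
  "no_isolated V E \<longleftrightarrow> (\<forall>v\<in>V. \<exists>u. adjacent E v u)"

definition every_edge_in_triangle :: "'a set set \<Rightarrow> bool" where
  "every_edge_in_triangle E \<longleftrightarrow>
     (\<forall>e\<in>E. \<exists>u v w. e = {u, v} \<and> {u, w} \<in> E \<and> {v, w} \<in> E \<and> w \<noteq> u \<and> w \<noteq> v)"

text \<open>Value of the domination game. The state is the currently dominated set
S = N[D] of the chosen vertices D; p = True means Dominator is to move.
A move v must be a vertex with N[v] - S nonempty; the game ends once S covers V.
Dominator minimises, Staller maximises the remaining number of moves.
The argument f is fuel; every legal move dominates a new vertex of V, so fuel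
card V suffices from the empty position.\<close>
fun dgame :: "'a set \<Rightarrow> 'a set set \<Rightarrow> nat \<Rightarrow> 'a set \<Rightarrow> bool \<Rightarrow> nat" where
  "dgame V E 0 S p = 0"
| "dgame V E (Suc f) S p =
     (if V \<subseteq> S then 0
      else 1 + (let R = (\<lambda>v. dgame V E f (S \<union> closed_nbhd E v) (\<not> p)) `
                          {v \<in> V. \<not> closed_nbhd E v \<subseteq> S}
                in if p then Min R else Max R))"

definition game_domination_number :: "'a set \<Rightarrow> 'a set set \<Rightarrow> nat" where
  "game_domination_number V E = dgame V E (card V) {} True"

end

theory Submission
  imports Defs
begin

text \<open>The proof plays a weight function against Staller. Let \<open>U\<close> be the set of undominated
  vertices. A vertex of \<open>U\<close> (white) has weight 15; a dominated vertex (blue) has weight 0, 6, 7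
  or 8 if it has 0, 1, 2 or at least 3 neighbours in \<open>U\<close>. Dominator can always choose a move such
  that the total weight falls by at least 54 during this move and Staller's reply, so each move
  costs 27 on average, and the initial weight is 15 per vertex. Staller's moves gain at least
  13, 14, 15, 16 as the white and blue degrees shrink, while Dominator finds a move gaining
  41, 40, 39, 38 in the corresponding phase. In the final phase every move gains 27 on its own.
  Only one property of the closed neighbourhoods is used: adjacent vertices have a common
  neighbour.\<close>

section \<open>Weights, the potential, and the loss of weight at a single vertex\<close>

definition beta :: "nat \<Rightarrow> int" where
  "beta k = (if k = 0 then 0 else if k = 1 then 6 else if k = 2 then 7 else 8)"

lemma beta_mono: "i \<le> j \<Longrightarrow> beta i \<le> beta j"
  by (auto simp: beta_def)

lemma beta_nonneg: "0 \<le> beta k" and beta_le: "beta k \<le> 8"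
  by (auto simp: beta_def)

lemma beta_simps [simp]:
  "beta 0 = 0" "beta (Suc 0) = 6" "beta 2 = 7" "beta 3 = 8" "beta 4 = 8"
  by (auto simp: beta_def)

text \<open>Common setting of both claims: \<open>N\<close> stands for the closed neighbourhood, and
  \<open>N_triangle\<close> is what 3-uniformity and the triangle condition both provide.\<close>

locale triangle_nbhd =
  fixes V :: "'a set" and N :: "'a \<Rightarrow> 'a set"
  assumes finite_V: "finite V"
    and N_subset: "v \<in> V \<Longrightarrow> N v \<subseteq> V"
    and N_refl: "v \<in> N v"
    and N_sym: "u \<in> N v \<Longrightarrow> v \<in> N u"
    and N_triangle: "u \<in> N v \<Longrightarrow> u \<noteq> v \<Longrightarrow> \<exists>w. w \<noteq> u \<and> w \<noteq> v \<and> w \<in> N u \<and> w \<in> N v"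
    and N_nontrivial: "v \<in> V \<Longrightarrow> \<exists>u. u \<in> N v \<and> u \<noteq> v"
begin

text \<open>For \<open>x\<close> in \<open>U\<close> the set \<open>N x \<inter> U\<close> contains
  \<open>x\<close> itself, so the degree bounds used for white vertices exceed the number of white
  neighbours by one; for blue vertices they count exactly.\<close>

definition weight :: "'a set \<Rightarrow> 'a \<Rightarrow> int" where
  "weight U x = (if x \<in> U then 15 else beta (card (N x \<inter> U)))"

definition potential :: "'a set \<Rightarrow> int" where
  "potential U = (\<Sum>x\<in>V. weight U x)"

definition drop_at :: "'a set \<Rightarrow> 'a \<Rightarrow> 'a \<Rightarrow> int" where
  "drop_at U v x = weight U x - weight (U - N v) x"

definition gain :: "'a set \<Rightarrow> 'a \<Rightarrow> int" where
  "gain U v = potential U - potential (U - N v)"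

lemma finite_U: "U \<subseteq> V \<Longrightarrow> finite U"
  using finite_V finite_subset by blast

lemma drop_nonneg:
  assumes "U \<subseteq> V" shows "0 \<le> drop_at U v x"
proof -
  have "card (N x \<inter> (U - N v)) \<le> card (N x \<inter> U)"
    using finite_U[OF assms] by (intro card_mono) auto
  then show ?thesis
    using beta_mono beta_le[of "card (N x \<inter> (U - N v))"]
    by (auto simp: drop_at_def weight_def)
qed

text \<open>The gain is the sum of all drops over \<open>V\<close> and no drop is negative, so a few
  well-chosen vertices suffice for a lower bound.\<close>

lemma sum_drop_le_gain:
  assumes "U \<subseteq> V" "A \<subseteq> V"
  shows "sum (drop_at U v) A \<le> gain U v"
proof -
  have "gain U v = sum (drop_at U v) V"
    by (simp add: gain_def potential_def drop_at_def sum_subtractf)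
  then show ?thesis
    using sum_mono2[OF finite_V assms(2), of "drop_at U v"] drop_nonneg[OF assms(1)] by simp
qed

lemma sum_list_drop_le_gain:
  assumes "U \<subseteq> V" "distinct xs" "set xs \<subseteq> V"
  shows "sum_list (map (drop_at U v) xs) \<le> gain U v"
  using sum_drop_le_gain[OF assms(1,3), of v] assms(2)
  by (simp add: sum_list_distinct_conv_sum_set)

text \<open>\<open>A\<close> collects white vertices around \<open>x\<close> that the move is known
  to dominate; the rest, at most \<open>k\<close>, may stay white.\<close>

lemma card_after_move:
  assumes "U \<subseteq> V" "A \<subseteq> N x \<inter> U \<inter> N v" "card (N x \<inter> U) \<le> k + card A"
  shows "card (N x \<inter> (U - N v)) \<le> k"
proof -
  have fin: "finite (N x \<inter> U)" using finite_U[OF assms(1)] by simp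
  have "card (N x \<inter> (U - N v)) \<le> card ((N x \<inter> U) - A)"
    using assms(2) fin by (intro card_mono) auto
  also have "\<dots> = card (N x \<inter> U) - card A"
    using assms(2) by (intro card_Diff_subset finite_subset[OF _ fin]) auto
  finally show ?thesis using assms(3) by simp
qed

lemma drop_self:
  assumes "v \<in> U" shows "drop_at U v v = 15"
proof -
  have "N v \<inter> (U - N v) = {}" by auto
  then show ?thesis using assms N_refl by (simp add: drop_at_def weight_def)
qed

lemma drop_self_blue:
  assumes "v \<notin> U" shows "drop_at U v v = beta (card (N v \<inter> U))"
proof -
  have "N v \<inter> (U - N v) = {}" by auto
  then show ?thesis using assms by (simp add: drop_at_def weight_def)
qed

lemma drop_white:
  assumes "U \<subseteq> V" "x \<in> U" "x \<in> N v" "A \<subseteq> N x \<inter> U \<inter> N v" "card (N x \<inter> U) \<le> k + card A"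
  shows "15 - beta k \<le> drop_at U v x"
  using card_after_move[OF assms(1,4,5)] assms(2,3) beta_mono
  by (auto simp: drop_at_def weight_def)

lemma drop_blue:
  assumes "U \<subseteq> V" "x \<notin> U" "A \<subseteq> N x \<inter> U \<inter> N v" "card (N x \<inter> U) \<le> k + card A"
  shows "beta (card (N x \<inter> U)) - beta k \<le> drop_at U v x"
  using card_after_move[OF assms(1,3,4)] assms(2) beta_mono
  by (auto simp: drop_at_def weight_def)

lemma card_ge:
  assumes "U \<subseteq> V" "set xs \<subseteq> N x \<inter> U" "distinct xs"
  shows "length xs \<le> card (N x \<inter> U)"
  using card_mono[OF _ assms(2)] finite_U[OF assms(1)] assms(3) by (simp add: distinct_card)

text \<open>\<open>beta\<close> is strictly increasing on 0, 1, 2, 3, so up to degree 3 losing a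
  white neighbour always costs a blue vertex at least 1.\<close>

lemma drop_blue1:
  assumes "U \<subseteq> V" "x \<notin> U" "card (N x \<inter> U) \<le> 3" "u \<in> N x" "u \<in> U" "u \<in> N v"
  shows "1 \<le> drop_at U v x"
proof -
  have "1 \<le> card (N x \<inter> U)" using card_ge[of U "[u]" x] assms by simp
  then have "card (N x \<inter> U) \<in> {1,2,3}" using assms(3) by auto
  then show ?thesis
    using drop_blue[OF assms(1,2), of "{u}" v "card (N x \<inter> U) - 1"] assms(4-6)
    by (auto simp: beta_def)
qed

lemma drop_blue2:
  assumes "U \<subseteq> V" "x \<notin> U" "card (N x \<inter> U) \<le> 3" "{u, w} \<subseteq> N x \<inter> U \<inter> N v" "u \<noteq> w"
  shows "2 \<le> drop_at U v x"
proof -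
  have "2 \<le> card (N x \<inter> U)" using card_ge[of U "[u,w]" x] assms by simp
  then have "card (N x \<inter> U) \<in> {2,3}" using assms(3) by auto
  then show ?thesis
    using drop_blue[OF assms(1,2,4), of "card (N x \<inter> U) - 2"] assms(5)
    by (auto simp: beta_def)
qed

lemma drop_white1:
  assumes "U \<subseteq> V" "x \<in> U" "x \<in> N v" "card (N x \<inter> U) \<le> Suc k"
  shows "15 - beta k \<le> drop_at U v x"
  using drop_white[OF assms(1-3), of "{x}" k] assms N_refl by simp

text \<open>A white \<open>v\<close> leaves \<open>N x \<inter> U\<close> together with
  \<open>x\<close>, so two elements are lost instead of one.\<close>

lemma drop_white2:
  assumes "U \<subseteq> V" "x \<in> U" "x \<in> N v" "v \<in> U" "x \<noteq> v" "card (N x \<inter> U) \<le> Suc (Suc k)"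
  shows "15 - beta k \<le> drop_at U v x"
  using drop_white[OF assms(1-3), of "{x,v}" k] assms N_refl N_sym[of x v] by simp

lemma drop_white_ge:
  assumes "U \<subseteq> V" "x \<in> U" "x \<in> N v"
  shows "7 \<le> drop_at U v x"
  using drop_white1[OF assms, of "card (N x \<inter> U)"] beta_le[of "card (N x \<inter> U)"] by simp

lemma third:
  assumes "v \<in> V" "u \<in> N v" "u \<noteq> v"
  obtains w where "w \<in> V" "w \<noteq> u" "w \<noteq> v" "w \<in> N u" "w \<in> N v" "u \<in> N w" "v \<in> N w"
  using N_triangle[OF assms(2,3)] N_sym N_subset[OF assms(1)] by blast

section \<open>Lower bounds for an arbitrary move\<close>

lemma move_white:
  assumes "U \<subseteq> V" "v \<in> U" shows "15 \<le> gain U v"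
  using sum_list_drop_le_gain[of U "[v]" v] assms drop_self[OF assms(2)] by auto

lemma move_blue:
  assumes "U \<subseteq> V" "v \<in> V" "v \<notin> U" "u \<in> N v" "u \<in> U"
  shows "beta (card (N v \<inter> U)) + drop_at U v u \<le> gain U v"
  using sum_list_drop_le_gain[of U "[v,u]" v] assms drop_self_blue[OF assms(3)] by auto

lemma beta_ge6: "1 \<le> k \<Longrightarrow> 6 \<le> beta k"
  by (simp add: beta_def)

lemma card_ge1:
  assumes "U \<subseteq> V" "u \<in> N v" "u \<in> U" shows "1 \<le> card (N v \<inter> U)"
  using card_ge[of U "[u]" v] assms by simp

text \<open>A white \<open>v\<close> loses 15. A blue \<open>v\<close> loses at least 6, and its
  white neighbour at least 15 - 8 = 7.\<close>

lemma move_ge_13: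
  assumes "U \<subseteq> V" "v \<in> V" "u \<in> N v" "u \<in> U"
  shows "13 \<le> gain U v"
proof (cases "v \<in> U")
  case True
  then show ?thesis using move_white[OF assms(1)] by force
next
  case False
  then show ?thesis
    using move_blue[OF assms(1,2) False assms(3,4)] beta_ge6[OF card_ge1[OF assms(1,3,4)]]
      drop_white_ge[OF assms(1,4,3)] by linarith
qed

text \<open>The dominated \<open>u\<close> now keeps at most 2 white neighbours, so it loses 15 - 7
  = 8 instead of 7.\<close>

lemma move_ge_14:
  assumes "U \<subseteq> V" "v \<in> V" "u \<in> N v" "u \<in> U" "\<And>x. x \<in> U \<Longrightarrow> card (N x \<inter> U) \<le> 3"
  shows "14 \<le> gain U v"
proof (cases "v \<in> U")
  case True
  then show ?thesis using move_white[OF assms(1)] by force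
next
  case False
  have "8 \<le> drop_at U v u"
    using drop_white1[OF assms(1,4,3), of 2] assms(5)[OF assms(4)] by simp
  then show ?thesis
    using move_blue[OF assms(1,2) False assms(3,4)] beta_ge6[OF card_ge1[OF assms(1,3,4)]]
    by linarith
qed

text \<open>A blue vertex forming a triangle with two adjacent white vertices loses a white neighbour
  as soon as one of the two is dominated.\<close>

lemma third_blue_drop:
  assumes "U \<subseteq> V" "v \<in> V" "v \<notin> U" "N v \<inter> U = {u}" "z \<in> V" "z \<notin> U" "card (N z \<inter> U) \<le> 3"
    "u \<in> N z" "w \<in> N z" "w \<in> U" "w \<noteq> u"
  shows "6 + drop_at U v u + 1 \<le> gain U v"
proof -
  have "z \<noteq> v" "u \<in> U" "u \<in> N v" using assms by auto
  moreover have "1 \<le> drop_at U v z"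
    using drop_blue1[OF assms(1,6,7), of u v] assms(4,8) by auto
  moreover have "drop_at U v v = 6" using drop_self_blue[OF assms(3)] assms(4) by simp
  moreover have "distinct [v,u,z]" "set [v,u,z] \<subseteq> V"
    using \<open>z \<noteq> v\<close> \<open>u \<in> U\<close> assms(1-3,5,6) by auto
  ultimately show ?thesis
    using sum_list_drop_le_gain[OF assms(1), of "[v,u,z]" v] by simp
qed

text \<open>One more than 6 + 8 is needed when \<open>v\<close> is blue. It comes from
  \<open>v\<close> itself if \<open>v\<close> has two white neighbours, and otherwise from a blue
  vertex completing a triangle with a white edge at \<open>u\<close>.\<close>

lemma move_ge_15:
  assumes U: "U \<subseteq> V" and v: "v \<in> V" and u: "u \<in> N v" "u \<in> U"
    and deg: "\<And>x. x \<in> V \<Longrightarrow> card (N x \<inter> U) \<le> 3"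
    and notri: "\<And>x y z. \<lbrakk>x \<in> U; y \<in> U; z \<in> U; x \<noteq> y; y \<noteq> z; x \<noteq> z; x \<in> N y; y \<in> N z\<rbrakk> \<Longrightarrow> x \<notin> N z"
  shows "15 \<le> gain U v"
proof (cases "v \<in> U")
  case True
  then show ?thesis using move_white[OF U] by force
next
  case False
  have du: "card (N u \<inter> U) \<le> 3" using deg u U by blast
  have drop8: "8 \<le> drop_at U v u" using drop_white1[OF U u(2,1), of 2] du by simp
  show ?thesis
  proof (cases "card (N v \<inter> U) = 1")
    case True
    then have Nv: "N v \<inter> U = {u}" using u by (metis IntI card_1_singletonE singletonD)
    show ?thesis
    proof (cases "N u \<inter> U \<subseteq> {u}")
      case True
      \<comment> \<open>\<open>u\<close> has no white neighbour, so its whole weight 15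
        disappears.\<close>
      then have "card (N u \<inter> U) \<le> Suc 0" using card_mono[OF _ True] by simp
      then have "15 \<le> drop_at U v u" using drop_white1[OF U u(2,1), of 0] by simp
      then show ?thesis
        using move_blue[OF U v False u] \<open>card (N v \<inter> U) = 1\<close> by simp
    next
      case False
      then obtain w where w: "w \<in> N u" "w \<in> U" "w \<noteq> u" by blast
      obtain z where z: "z \<in> V" "z \<noteq> w" "z \<noteq> u" "z \<in> N w" "z \<in> N u" "w \<in> N z" "u \<in> N z"
        using third[OF _ w(1,3)] u(2) U by blast
      have "z \<notin> U" using notri[of w u z] w z u N_sym by blast
      then show ?thesis
        using third_blue_drop[OF U v \<open>v \<notin> U\<close> Nv z(1) _ deg[OF z(1)] z(7,6) w(2,3)] drop8 by simp
    qed
  next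
    case False
    then have "2 \<le> card (N v \<inter> U)" using card_ge1[OF U u] by simp
    then have "7 \<le> beta (card (N v \<inter> U))" by (simp add: beta_def)
    then show ?thesis using move_blue[OF U v \<open>v \<notin> U\<close> u] drop8 by simp
  qed
qed

text \<open>White vertices now have at most one white neighbour, so a dominated one loses 15 - 6 =
  9, and the blue cases give 6 + 9 + 1 or 7 + 9. A white \<open>v\<close> adds to its 15 the loss of
  some neighbour.\<close>

lemma move_ge_16:
  assumes U: "U \<subseteq> V" and v: "v \<in> V" and u: "u \<in> N v" "u \<in> U"
    and deg: "\<And>x. x \<in> V \<Longrightarrow> card (N x \<inter> U) \<le> 3"
    and degU: "\<And>x. x \<in> U \<Longrightarrow> card (N x \<inter> U) \<le> 2"
  shows "16 \<le> gain U v"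
proof (cases "v \<in> U")
  case True
  show ?thesis
  proof (cases "N v \<inter> U \<subseteq> {v}")
    case single: True
    obtain y where y: "y \<in> N v" "y \<noteq> v" using N_nontrivial[OF v] by blast
    then have yV: "y \<in> V" and "y \<notin> U" using N_subset[OF v] single by auto
    then have "1 \<le> drop_at U v y"
      using drop_blue1[OF U _ deg, of y v v] N_sym[OF y(1)] N_refl True by simp
    then show ?thesis
      using sum_list_drop_le_gain[of U "[v,y]" v] U v yV y drop_self[OF True] by auto
  next
    case False
    then obtain w where w: "w \<in> N v" "w \<in> U" "w \<noteq> v" by blast
    have "7 \<le> drop_at U v w" using drop_white_ge[OF U w(2,1)] .
    then show ?thesis
      using sum_list_drop_le_gain[of U "[v,w]" v] U v w drop_self[OF True] by auto
  qed
next
  case False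
  have drop9: "9 \<le> drop_at U v x" if "x \<in> N v" "x \<in> U" for x
    using drop_white1[OF U that(2,1), of 1] degU[OF that(2)] by simp
  show ?thesis
  proof (cases "card (N v \<inter> U) = 1")
    case True
    then have Nv: "N v \<inter> U = {u}" using u by (metis IntI card_1_singletonE singletonD)
    show ?thesis
    proof (cases "N u \<inter> U \<subseteq> {u}")
      case True
      then have "card (N u \<inter> U) \<le> Suc 0" using card_mono[OF _ True] by simp
      then have "15 \<le> drop_at U v u" using drop_white1[OF U u(2,1), of 0] by simp
      then show ?thesis
        using move_blue[OF U v False u] \<open>card (N v \<inter> U) = 1\<close> by simp
    next
      case False
      then obtain w where w: "w \<in> N u" "w \<in> U" "w \<noteq> u" by blast
      obtain z where z: "z \<in> V" "z \<noteq> w" "z \<noteq> u" "z \<in> N w" "z \<in> N u" "w \<in> N z" "u \<in> N z"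
        using third[OF _ w(1,3)] u(2) U by blast
      \<comment> \<open>A white \<open>z\<close> would be a third element of
        \<open>N u \<inter> U\<close> besides \<open>u\<close> and \<open>w\<close>.\<close>
      have "z \<notin> U"
        using card_ge[OF U, of "[u,w,z]" u] degU[OF u(2)] w z u N_refl by auto
      then show ?thesis
        using third_blue_drop[OF U v \<open>v \<notin> U\<close> Nv z(1) _ deg[OF z(1)] z(7,6) w(2,3)] drop9[OF u]
        by simp
    qed
  next
    case False
    then have "2 \<le> card (N v \<inter> U)" using card_ge1[OF U u] by simp
    then have "7 \<le> beta (card (N v \<inter> U))" by (simp add: beta_def)
    then show ?thesis using move_blue[OF U v \<open>v \<notin> U\<close> u] drop9[OF u] by simp
  qed
qed

section \<open>Good moves for Dominator\<close>

text \<open>15 + 4 * 7 for a white \<open>v\<close> and 8 + 5 * 7 for a blue one both equal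
  43.\<close>

lemma dominate_five:
  assumes U: "U \<subseteq> V" and v: "v \<in> V" and d: "5 \<le> card (N v \<inter> U)"
  shows "43 \<le> gain U v"
proof -
  have fin: "finite (N v \<inter> U)" using finite_U[OF U] by simp
  have each: "7 \<le> drop_at U v x" if "x \<in> N v \<inter> U" for x
    using drop_white_ge[OF U] that by blast
  show ?thesis
  proof (cases "v \<in> U")
    case True
    have "int (card (N v \<inter> U - {v})) * 7 \<le> sum (drop_at U v) (N v \<inter> U - {v})"
      using each by (intro sum_bounded_below) auto
    moreover have "4 \<le> card (N v \<inter> U - {v})"
      using d True N_refl by simp
    ultimately have "28 \<le> sum (drop_at U v) (N v \<inter> U - {v})" by linarith
    then have "43 \<le> sum (drop_at U v) (N v \<inter> U)"
      using sum.remove[OF fin, of v "drop_at U v"] True N_refl[of v] drop_self[OF True] by simp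
    then show ?thesis
      using sum_drop_le_gain[OF U, of "N v \<inter> U" v] U by (simp add: le_infI2)
  next
    case False
    have "int (card (N v \<inter> U)) * 7 \<le> sum (drop_at U v) (N v \<inter> U)"
      using each by (intro sum_bounded_below) auto
    then have "35 \<le> sum (drop_at U v) (N v \<inter> U)" using d by linarith
    moreover have "drop_at U v v = 8"
      using drop_self_blue[OF False] d by (simp add: beta_def)
    ultimately have "43 \<le> sum (drop_at U v) (insert v (N v \<inter> U))"
      using fin False by simp
    moreover have "insert v (N v \<inter> U) \<subseteq> V" using U v by auto
    ultimately show ?thesis
      using sum_drop_le_gain[OF U, of "insert v (N v \<inter> U)" v] by linarith
  qed
qed

text \<open>\<open>v\<close> loses 8, and each of its four white neighbours loses at least 15 - 7 =
  8.\<close>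

lemma dominate_blue_four:
  assumes U: "U \<subseteq> V" and v: "v \<in> V" "v \<notin> U" and d: "card (N v \<inter> U) = 4"
    and degU: "\<And>x. x \<in> U \<Longrightarrow> card (N x \<inter> U) \<le> 3"
  shows "40 \<le> gain U v"
proof -
  have fin: "finite (N v \<inter> U)" using finite_U[OF U] by simp
  have "int (card (N v \<inter> U)) * 8 \<le> sum (drop_at U v) (N v \<inter> U)"
    using drop_white1[OF U, of _ v 2] degU by (intro sum_bounded_below) fastforce
  then have "40 \<le> sum (drop_at U v) (insert v (N v \<inter> U))"
    using fin v d drop_self_blue[OF v(2)] by simp
  moreover have "insert v (N v \<inter> U) \<subseteq> V" using U v by auto
  ultimately show ?thesis
    using sum_drop_le_gain[OF U, of "insert v (N v \<inter> U)" v] by linarith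
qed

text \<open>Since \<open>beta 4 = beta 3\<close>, the first loss from degree 4 is free; hence two
  lost neighbours guarantee only 1, and three guarantee 2.\<close>

lemma drop_blue_four:
  assumes "U \<subseteq> V" "x \<notin> U" "card (N x \<inter> U) \<le> 4" "{u, v} \<subseteq> N x \<inter> U \<inter> N v" "u \<noteq> v"
  shows "1 \<le> drop_at U v x"
    and "\<lbrakk>w \<in> N x \<inter> U \<inter> N v; w \<noteq> u; w \<noteq> v\<rbrakk> \<Longrightarrow> 2 \<le> drop_at U v x"
proof -
  have "2 \<le> card (N x \<inter> U)" using card_ge[of U "[u,v]" x] assms by simp
  then have "card (N x \<inter> U) \<in> {2,3,4}" using assms(3) by auto
  then show "1 \<le> drop_at U v x"
    using drop_blue[OF assms(1,2,4), of "card (N x \<inter> U) - 2"] assms(5)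
    by (auto simp: beta_def)
  assume w: "w \<in> N x \<inter> U \<inter> N v" "w \<noteq> u" "w \<noteq> v"
  have "3 \<le> card (N x \<inter> U)" using card_ge[of U "[u,v,w]" x] assms w by simp
  then have "card (N x \<inter> U) \<in> {3,4}" using assms(3) by auto
  then show "2 \<le> drop_at U v x"
    using drop_blue[OF assms(1,2), of "{u,v,w}" v "card (N x \<inter> U) - 3"] assms(4,5) w
    by (auto simp: beta_def)
qed

text \<open>The three white neighbours give 15 + 3 * 8 = 39. The missing 2 come from an edge among
  them, or else from blue common neighbours of \<open>v\<close> with two of them.\<close>

lemma dominate_white_four:
  assumes U: "U \<subseteq> V" and v: "v \<in> U" and d: "card (N v \<inter> U) = 4"
    and deg: "\<And>x. x \<in> V \<Longrightarrow> card (N x \<inter> U) \<le> 4"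
  shows "41 \<le> gain U v"
proof -
  have vV: "v \<in> V" using U v by auto
  have drop8: "8 \<le> drop_at U v x" if "x \<in> N v" "x \<in> U" "x \<noteq> v" for x
    using drop_white2[OF U that(2,1) v that(3), of 2] deg[of x] U that(2) by auto
  have drop9: "9 \<le> drop_at U v x"
    if "x \<in> N v" "x \<in> U" "x \<noteq> v" "y \<in> N v" "y \<in> U" "y \<noteq> v" "y \<noteq> x" "y \<in> N x" for x y
    using drop_white[OF U that(2,1), of "{x,v,y}" 1] deg[of x] U that v N_refl N_sym[of x v]
    by auto
  have "card (N v \<inter> U - {v}) = 3" using d v N_refl by simp
  then obtain a b c where abc: "N v \<inter> U - {v} = {a,b,c}" "a \<noteq> b" "b \<noteq> c" "a \<noteq> c"
    by (auto simp: card_3_iff)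
  then have mem: "a \<in> N v" "a \<in> U" "a \<noteq> v" "b \<in> N v" "b \<in> U" "b \<noteq> v" "c \<in> N v" "c \<in> U" "c \<noteq> v"
    by auto
  have vN: "v \<in> N a" "v \<in> N b" "v \<in> N c" using mem N_sym by auto
  have sum4: "15 + drop_at U v a + drop_at U v b + drop_at U v c \<le> gain U v"
    using sum_list_drop_le_gain[of U "[v,a,b,c]" v] abc(2-4) mem U v drop_self[OF v]
    by (simp add: subsetD[OF U])
  have sum5: "39 + drop_at U v x \<le> gain U v" if "x \<in> V" "x \<notin> U" for x
  proof -
    have "x \<noteq> v" "x \<noteq> a" "x \<noteq> b" "x \<noteq> c" using that mem v by auto
    then have "15 + drop_at U v a + drop_at U v b + drop_at U v c + drop_at U v x \<le> gain U v"
      using sum_list_drop_le_gain[of U "[v,a,b,c,x]" v] abc(2-4) mem that U v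
        drop_self[OF v] by (simp add: subsetD[OF U])
    then show ?thesis using drop8[of a] drop8[of b] drop8[of c] mem by linarith
  qed
  show ?thesis
  \<comment> \<open>Both ends of an edge inside \<open>{a,b,c}\<close> lose one further white
    neighbour, hence 9 instead of 8.\<close>
  proof (cases "b \<in> N a \<or> c \<in> N b \<or> c \<in> N a")
    case True
    then show ?thesis
    proof (elim disjE)
      assume "b \<in> N a"
      then have "9 \<le> drop_at U v a" "9 \<le> drop_at U v b"
        using drop9[of a b] drop9[of b a] mem abc(2) N_sym by auto
      then show ?thesis using sum4 drop8[of c] mem by linarith
    next
      assume "c \<in> N b"
      then have "9 \<le> drop_at U v b" "9 \<le> drop_at U v c"
        using drop9[of b c] drop9[of c b] mem abc(3) N_sym by auto
      then show ?thesis using sum4 drop8[of a] mem by linarith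
    next
      assume "c \<in> N a"
      then have "9 \<le> drop_at U v a" "9 \<le> drop_at U v c"
        using drop9[of a c] drop9[of c a] mem abc(4) N_sym by auto
      then show ?thesis using sum4 drop8[of b] mem by linarith
    qed
  next
    case False
    obtain x where x: "x \<in> V" "x \<noteq> a" "x \<noteq> v" "x \<in> N a" "x \<in> N v" "a \<in> N x" "v \<in> N x"
      using third[OF vV mem(1,3)] by blast
    obtain y where y: "y \<in> V" "y \<noteq> b" "y \<noteq> v" "y \<in> N b" "y \<in> N v" "b \<in> N y" "v \<in> N y"
      using third[OF vV mem(4,6)] by blast
    \<comment> \<open>A white \<open>x\<close> would be \<open>b\<close> or \<open>c\<close>, hence
      adjacent to \<open>a\<close>; the same reasoning applies to \<open>y\<close> and
      \<open>b\<close>.\<close>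
    have xU: "x \<notin> U" using x abc(1) False by blast
    have "a \<notin> N b" using False N_sym[of a b] by blast
    moreover have "c \<notin> N b" using False by blast
    moreover have "y \<in> {a,b,c}" if "y \<in> U" using that y(3,5) unfolding abc(1)[symmetric] by blast
    ultimately have yU: "y \<notin> U" using y(2,4) by auto
    have x1: "1 \<le> drop_at U v x"
      using drop_blue_four(1)[OF U xU deg[OF x(1)], of a v] x mem v N_refl by auto
    have y1: "1 \<le> drop_at U v y"
      using drop_blue_four(1)[OF U yU deg[OF y(1)], of b v] y mem v N_refl by auto
    show ?thesis
    \<comment> \<open>If the two blue vertices coincide, that vertex loses the three white
      neighbours \<open>a\<close>, \<open>b\<close>, \<open>v\<close> and contributes 2 alone;
      otherwise each contributes 1.\<close>
    proof (cases "x = y")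
      case True
      then have "2 \<le> drop_at U v x"
        using drop_blue_four(2)[OF U xU deg[OF x(1)], of a v b] x y mem v N_refl abc(2) by auto
      then show ?thesis using sum5[OF x(1) xU] by linarith
    next
      case False
      have "x \<noteq> a" "x \<noteq> b" "x \<noteq> c" "y \<noteq> a" "y \<noteq> b" "y \<noteq> c" using xU yU mem by auto
      then have "15 + drop_at U v a + drop_at U v b + drop_at U v c + drop_at U v x + drop_at U v y
          \<le> gain U v"
        using sum_list_drop_le_gain[of U "[v,a,b,c,x,y]" v] abc(2-4) mem U x y False v
          drop_self[OF v] by (simp add: subsetD[OF U])
      then show ?thesis using drop8[of a] drop8[of b] drop8[of c] mem x1 y1 by linarith
    qed
  qed
qed

text \<open>By the degree bound, \<open>y\<close> and \<open>z\<close> have no white neighbours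
  outside the triangle, so all three vertices drop from 15 to 0.\<close>

lemma dominate_white_triangle:
  assumes U: "U \<subseteq> V" and degU: "\<And>x. x \<in> U \<Longrightarrow> card (N x \<inter> U) \<le> 3"
    and tri: "x \<in> U" "y \<in> U" "z \<in> U" "x \<noteq> y" "y \<noteq> z" "x \<noteq> z" "x \<in> N y" "y \<in> N z" "x \<in> N z"
  shows "45 \<le> gain U x"
proof -
  have yz: "y \<in> N x" "z \<in> N x" "z \<in> N y" using tri N_sym by auto
  have "15 \<le> drop_at U x y"
    using drop_white[OF U tri(2) yz(1), of "{x,y,z}" 0] tri yz N_refl degU[of y] by auto
  moreover have "15 \<le> drop_at U x z"
    using drop_white[OF U tri(3) yz(2), of "{x,y,z}" 0] tri yz N_refl degU[of z] by auto
  ultimately show ?thesis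
    using sum_list_drop_le_gain[of U "[x,y,z]" x] U tri drop_self[OF tri(1)]
    by (simp add: subsetD[OF U])
qed

lemma card_le_3_mem:
  assumes "U \<subseteq> V" "card (N z \<inter> U) \<le> 3" "{a,b,c,e} \<subseteq> N z \<inter> U" "a \<noteq> b" "a \<noteq> c" "b \<noteq> c"
    "a \<noteq> e" "b \<noteq> e"
  shows "e = c"
proof (rule ccontr)
  assume "e \<noteq> c"
  then show False using card_ge[OF assms(1), of "[a,b,c,e]" z] assms by auto
qed

text \<open>Playing \<open>v\<close> yields 15 + 9 + 9 = 33 from the path \<open>u\<close>,
  \<open>v\<close>, \<open>w\<close>. Unless an end of the path loses all 15 or a blue vertex sees a
  whole white path, four distinct blue vertices supply the missing 2 + 2 + 1 + 1.\<close>

lemma dominate_white_path: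
  assumes U: "U \<subseteq> V" and v: "v \<in> U" and d: "card (N v \<inter> U) = 3"
    and deg: "\<And>x. x \<in> V \<Longrightarrow> card (N x \<inter> U) \<le> 3"
    and notri: "\<And>x y z. \<lbrakk>x \<in> U; y \<in> U; z \<in> U; x \<noteq> y; y \<noteq> z; x \<noteq> z; x \<in> N y; y \<in> N z\<rbrakk> \<Longrightarrow> x \<notin> N z"
  shows "\<exists>v\<in>V. 39 \<le> gain U v"
proof -
  have drop9: "9 \<le> drop_at U c x" if "c \<in> U" "x \<in> N c" "x \<in> U" "x \<noteq> c" for c x
    using drop_white2[OF U that(3,2,1,4), of 1] deg[of x] U that(3) by auto
  \<comment> \<open>A blue \<open>z\<close> seeing a white path with centre \<open>c\<close> has no
    other white neighbours, so it loses all of its 8.\<close>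
  have cover: "39 \<le> gain U c"
    if "c \<in> U" "a \<in> U" "b \<in> U" "a \<noteq> c" "b \<noteq> c" "a \<noteq> b" "a \<in> N c" "b \<in> N c"
      "z \<in> V" "z \<notin> U" "a \<in> N z" "b \<in> N z" "c \<in> N z" for a b c z
  proof -
    have "card (N z \<inter> U) = 3"
      using card_ge[OF U, of "[a,b,c]" z] deg[OF that(9)] that by auto
    then have "8 \<le> drop_at U c z"
      using drop_blue[OF U that(10), of "{a,b,c}" c 0] that N_refl by auto
    moreover have "z \<noteq> a" "z \<noteq> b" "z \<noteq> c" using that by auto
    ultimately show ?thesis
      using sum_list_drop_le_gain[of U "[c,a,b,z]" c] that U drop_self[OF that(1)]
        drop9[of c a] drop9[of c b] by (simp add: subsetD[OF U])
  qed
  show ?thesis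
  proof (cases "\<exists>a b c z. c \<in> U \<and> a \<in> U \<and> b \<in> U \<and> a \<noteq> c \<and> b \<noteq> c \<and> a \<noteq> b \<and> a \<in> N c \<and> b \<in> N c
      \<and> z \<in> V \<and> z \<notin> U \<and> a \<in> N z \<and> b \<in> N z \<and> c \<in> N z")
    case True
    then show ?thesis using cover U by blast
  next
    case False
    then have nocover: False
      if "c \<in> U" "a \<in> U" "b \<in> U" "a \<noteq> c" "b \<noteq> c" "a \<noteq> b" "a \<in> N c" "b \<in> N c"
        "z \<in> V" "z \<notin> U" "a \<in> N z" "b \<in> N z" "c \<in> N z" for a b c z
      using that by blast
    have vV: "v \<in> V" using U v by auto
    have "card (N v \<inter> U - {v}) = 2" using d v N_refl by simp
    then obtain u w where uw: "N v \<inter> U - {v} = {u,w}" "u \<noteq> w"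
      by (auto simp: card_2_iff)
    then have u: "u \<in> N v" "u \<in> U" "u \<noteq> v" and w: "w \<in> N v" "w \<in> U" "w \<noteq> v" by auto
    have vN: "v \<in> N u" "v \<in> N w" using u w N_sym by auto
    have uw_nonadj: "u \<notin> N w" "w \<notin> N u"
      using notri[of u v w] notri[of w v u] u w v uw(2) vN by auto
    have sum3: "15 + drop_at U v u + drop_at U v w \<le> gain U v"
      using sum_list_drop_le_gain[of U "[v,u,w]" v] u w v U uw(2) drop_self[OF v]
      by (simp add: subsetD[OF U])
    \<comment> \<open>An end of the path whose only white neighbour is \<open>v\<close> loses 15
      instead of 9, and 15 + 15 + 9 = 39.\<close>
    have end39: "39 \<le> gain U v"
      if "card (N u \<inter> U) \<le> 2 \<or> card (N w \<inter> U) \<le> 2"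
    proof -
      have "15 \<le> drop_at U v x" if "card (N x \<inter> U) \<le> 2" "x \<in> N v" "x \<in> U" "x \<noteq> v" for x
        using drop_white2[OF U that(3,2) v that(4), of 0] that(1) by simp
      then have "15 \<le> drop_at U v u \<or> 15 \<le> drop_at U v w" using that u w by blast
      then show ?thesis using sum3 drop9[OF v, of u] drop9[OF v, of w] u w by linarith
    qed
    \<comment> \<open>The common neighbour of \<open>t\<close> and \<open>v\<close> is blue for lack
      of white triangles, and it loses both of them.\<close>
    have third_v: "\<exists>x. x \<in> V \<and> x \<notin> U \<and> t \<in> N x \<and> v \<in> N x \<and> 2 \<le> drop_at U v x"
      if t: "t \<in> N v" "t \<in> U" "t \<noteq> v" for t
    proof -
      obtain x where x: "x \<in> V" "x \<noteq> t" "x \<noteq> v" "x \<in> N t" "x \<in> N v" "t \<in> N x" "v \<in> N x"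
        using third[OF vV t(1,3)] by blast
      have "x \<notin> U" using notri[of t v x] x t v by blast
      moreover have "2 \<le> drop_at U v x"
        using drop_blue2[OF U \<open>x \<notin> U\<close> deg[OF x(1)], of t v v] x t v N_refl by auto
      ultimately show ?thesis using x by blast
    qed
    \<comment> \<open>If \<open>t\<close> has another white neighbour \<open>t'\<close>, their
      common blue neighbour loses \<open>t\<close>. It does not see \<open>v\<close>, since
      otherwise it would see the white path \<open>v\<close>, \<open>t\<close>,
      \<open>t'\<close>.\<close>
    have third_next: "\<exists>t' z. t' \<in> U \<and> t' \<in> N t \<and> t' \<noteq> t \<and> t' \<noteq> v \<and> z \<in> V \<and> z \<notin> U \<and> t \<in> N z
        \<and> t' \<in> N z \<and> v \<notin> N z \<and> 1 \<le> drop_at U v z"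
      if t: "t \<in> N v" "t \<in> U" "t \<noteq> v" "\<not> card (N t \<inter> U) \<le> 2" for t
    proof -
      have "\<not> N t \<inter> U \<subseteq> {t,v}"
        using t(4) card_mono[of "{t,v}" "N t \<inter> U"] t(3) by auto
      then obtain t' where t': "t' \<in> U" "t' \<in> N t" "t' \<noteq> t" "t' \<noteq> v" by blast
      obtain z where z: "z \<in> V" "z \<noteq> t'" "z \<noteq> t" "z \<in> N t'" "z \<in> N t" "t' \<in> N z" "t \<in> N z"
        using third[OF _ t'(2,3)] t(2) U by blast
      have "z \<notin> U" using notri[of t' t z] z t t' by blast
      moreover have "v \<notin> N z"
        using nocover[of t v t' z] z t t' v N_sym[OF t(1)] \<open>z \<notin> U\<close> by blast
      moreover have "1 \<le> drop_at U v z"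
        using drop_blue1[OF U \<open>z \<notin> U\<close> deg[OF z(1)], of t v] z t by auto
      ultimately show ?thesis using t' z by blast
    qed
    show ?thesis
    proof (cases "card (N u \<inter> U) \<le> 2 \<or> card (N w \<inter> U) \<le> 2")
      case True
      then show ?thesis using end39 vV by blast
    next
      case False
      obtain x where x: "x \<in> V" "x \<notin> U" "u \<in> N x" "v \<in> N x" "2 \<le> drop_at U v x"
        using third_v[OF u] by blast
      obtain y where y: "y \<in> V" "y \<notin> U" "w \<in> N y" "v \<in> N y" "2 \<le> drop_at U v y"
        using third_v[OF w] by blast
      obtain u' z where z: "u' \<in> U" "u' \<in> N u" "u' \<noteq> u" "u' \<noteq> v" "z \<in> V" "z \<notin> U" "u \<in> N z"
          "u' \<in> N z" "v \<notin> N z" "1 \<le> drop_at U v z"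
        using third_next[OF u] False by blast
      obtain w' t where t: "w' \<in> U" "w' \<in> N w" "w' \<noteq> w" "w' \<noteq> v" "t \<in> V" "t \<notin> U" "w \<in> N t"
          "w' \<in> N t" "v \<notin> N t" "1 \<le> drop_at U v t"
        using third_next[OF w] False by blast
      \<comment> \<open>A common vertex would see the whole path \<open>u\<close>, \<open>v\<close>,
        \<open>w\<close>.\<close>
      have "x \<noteq> y" using nocover[of v u w x] x y u w v uw(2) by blast
      have ne: "u' \<noteq> w" "w' \<noteq> u" using z t uw_nonadj by auto
      have "z \<noteq> t"
      proof
        assume "z = t"
        \<comment> \<open>At most three white vertices are seen by \<open>z\<close>, which forces
          the two outer neighbours to coincide; then \<open>z\<close> sees the white path
          \<open>u\<close>, \<open>u'\<close>, \<open>w\<close>.\<close>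
        then have "w' = u'"
          using card_le_3_mem[OF U deg[OF z(5)], of u w u' w'] z t u w uw(2) ne by auto
        then show False
          using nocover[of u' u w z] z t u w uw(2) ne N_sym \<open>z = t\<close> by blast
      qed
      have "distinct [v,u,w,x,y,z,t]"
        using v u w uw(2) x y z t \<open>x \<noteq> y\<close> \<open>z \<noteq> t\<close> by auto
      then have "15 + drop_at U v u + drop_at U v w + drop_at U v x + drop_at U v y
          + drop_at U v z + drop_at U v t \<le> gain U v"
        using sum_list_drop_le_gain[OF U, of "[v,u,w,x,y,z,t]" v] drop_self[OF v] v u w x y z t
        by (simp add: subsetD[OF U])
      then have "39 \<le> gain U v"
        using drop9[OF v, of u] drop9[OF v, of w] u w x y z t by linarith
      then show ?thesis using vV by blast
    qed
  qed
qed

text \<open>In the final phase all vertices of a closed neighbourhood \<open>N v\<close> with \<open>v\<close> undominated see the same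
  undominated vertices, so whichever move dominates \<open>v\<close> removes the weight of the whole of \<open>N v\<close>.\<close>

definition safe :: "'a set \<Rightarrow> bool" where
  "safe U \<longleftrightarrow> (\<forall>v\<in>U. \<forall>x\<in>N v. N x \<inter> U = N v \<inter> U)"

lemma safe_Diff: "safe U \<Longrightarrow> safe (U - N v)"
  unfolding safe_def by blast

text \<open>The 27 is 15 for \<open>u\<close> plus 6 for each of two further vertices of
  \<open>N u\<close>, a neighbour and a common neighbour, all of which drop to weight 0.\<close>

lemma safe_move:
  assumes U: "U \<subseteq> V" and v: "v \<in> V" and u: "u \<in> N v" "u \<in> U" and "safe U"
  shows "27 \<le> gain U v"
proof -
  have uV: "u \<in> V" using U u by auto
  have same: "N x \<inter> U = N u \<inter> U" if "x \<in> N u" for x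
    using \<open>safe U\<close> that u unfolding safe_def by blast
  have vu: "v \<in> N u" using N_sym u by blast
  have zero: "weight (U - N v) x = 0" if "x \<in> N u" for x
  proof -
    have "N x \<inter> U = N v \<inter> U" using same[OF that] same[OF vu] by simp
    then have "N x \<inter> (U - N v) = {}" by auto
    moreover have "x \<notin> U - N v" using \<open>N x \<inter> U = N v \<inter> U\<close> N_refl by blast
    ultimately show ?thesis by (simp add: weight_def)
  qed
  have six: "6 \<le> drop_at U v x" if "x \<in> N u" for x
  proof -
    have "1 \<le> card (N x \<inter> U)" using card_ge1[OF U _ u(2)] N_sym[OF that] by blast
    then show ?thesis using zero[OF that] beta_ge6 by (simp add: drop_at_def weight_def)
  qed
  have fifteen: "15 \<le> drop_at U v u"
    using zero[OF N_refl] u by (simp add: drop_at_def weight_def)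
  obtain a where a: "a \<in> N u" "a \<noteq> u" using N_nontrivial[OF uV] by blast
  obtain b where b: "b \<in> V" "b \<noteq> a" "b \<noteq> u" "b \<in> N u" using third[OF uV a] by metis
  have "a \<in> V" using N_subset[OF uV] a by auto
  then have "drop_at U v u + drop_at U v a + drop_at U v b \<le> gain U v"
    using sum_list_drop_le_gain[of U "[u,a,b]" v] U uV a b by auto
  then show ?thesis using fifteen six[OF a(1)] six[OF b(4)] by linarith
qed

text \<open>Playing a common neighbour \<open>t\<close> of the isolated white edge \<open>u\<close>,
  \<open>v\<close> gains 30 from its ends. The other 8 come from \<open>t\<close> itself, or as 7
  from \<open>t\<close> and 1 from \<open>x\<close>.\<close>

lemma dominate_white_edge:
  assumes U: "U \<subseteq> V" and v: "v \<in> U" "u \<in> U" "u \<in> N v" "u \<noteq> v" and x: "x \<in> N v" "x \<notin> U"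
    and diff: "N x \<inter> U \<noteq> N v \<inter> U"
    and deg: "\<And>x. x \<in> V \<Longrightarrow> card (N x \<inter> U) \<le> 3"
    and degU: "\<And>x. x \<in> U \<Longrightarrow> card (N x \<inter> U) \<le> 2"
  shows "\<exists>v\<in>V. 38 \<le> gain U v"
proof -
  have vV: "v \<in> V" and uV: "u \<in> V" using U v by auto
  then have xV: "x \<in> V" using N_subset x by blast
  have vu: "v \<in> N u" using N_sym v by blast
  have pair: "N c \<inter> U = {a,b}" if "a \<in> N c" "a \<in> U" "b \<in> N c" "b \<in> U" "a \<noteq> b" "card (N c \<inter> U) \<le> 2"
    for a b c
  proof -
    have "finite (N c \<inter> U)" "{a,b} \<subseteq> N c \<inter> U" using finite_U[OF U] that by auto
    then show ?thesis using card_seteq[of "N c \<inter> U" "{a,b}"] that by simp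
  qed
  obtain t where t: "t \<in> V" "t \<noteq> u" "t \<noteq> v" "t \<in> N u" "t \<in> N v" "u \<in> N t" "v \<in> N t"
    using third[OF vV v(3,4)] by blast
  have Nv: "N v \<inter> U = {v,u}" using pair[of v v u] v degU N_refl by auto
  have tU: "t \<notin> U" using Nv t by blast
  have du: "15 \<le> drop_at U t u"
    using drop_white[OF U v(2) t(6), of "{u,v}" 0] degU[OF v(2)] t v vu N_refl by auto
  have dv: "15 \<le> drop_at U t v"
    using drop_white[OF U v(1) t(7), of "{u,v}" 0] degU[OF v(1)] t v vu N_refl by auto
  show ?thesis
  proof (cases "card (N t \<inter> U) \<le> 2")
    case False
    then have "card (N t \<inter> U) = 3" using deg[OF t(1)] by simp
    moreover have "\<not> N t \<inter> U \<subseteq> {u,v}"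
      using False card_mono[of "{u,v}" "N t \<inter> U"] v(4) by auto
    then obtain y where y: "y \<in> N t" "y \<in> U" "y \<noteq> u" "y \<noteq> v" by blast
    have "7 \<le> drop_at U t y" using drop_white_ge[OF U y(2,1)] .
    moreover have "y \<noteq> t" using y tU by auto
    ultimately have "38 \<le> gain U t"
      using sum_list_drop_le_gain[of U "[t,u,v,y]" t] U t tU y v du dv drop_self_blue[OF tU]
      by (simp add: subsetD[OF U])
    then show ?thesis using t by blast
  next
    case True
    then have Nt: "N t \<inter> U = {v,u}" using pair[of v t u] t v by auto
    \<comment> \<open>\<open>t\<close> sees the same white vertices as \<open>v\<close>, whereas
      \<open>x\<close> does not.\<close>
    then have "x \<noteq> t" using diff Nv by auto
    moreover have "1 \<le> drop_at U t x"
      using drop_blue1[OF U x(2) deg[OF xV], of v t] N_sym[OF x(1)] v t by auto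
    moreover have "drop_at U t t = 7"
      using drop_self_blue[OF tU] Nt v(4) by (simp add: numeral_2_eq_2[symmetric])
    moreover have "x \<noteq> u" "x \<noteq> v" using x v by auto
    ultimately have "38 \<le> gain U t"
      using sum_list_drop_le_gain[of U "[t,u,v,x]" t] U t tU xV v du dv
      by (simp add: subsetD[OF U])
    then show ?thesis using t by blast
  qed
qed

text \<open>A witness against safety is a blue \<open>x\<close> next to a white \<open>v\<close>.
  Either a white edge near \<open>x\<close> allows the previous lemma, or playing \<open>x\<close>
  dominates several white vertices at once.\<close>

lemma dominate_unsafe:
  assumes U: "U \<subseteq> V" and unsafe: "\<not> safe U"
    and deg: "\<And>x. x \<in> V \<Longrightarrow> card (N x \<inter> U) \<le> 3"
    and degU: "\<And>x. x \<in> U \<Longrightarrow> card (N x \<inter> U) \<le> 2"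
  shows "\<exists>v\<in>V. 38 \<le> gain U v"
proof -
  obtain v x where v: "v \<in> U" and x: "x \<in> N v" and diff: "N x \<inter> U \<noteq> N v \<inter> U"
    using unsafe unfolding safe_def by blast
  have vV: "v \<in> V" using U v by auto
  then have xV: "x \<in> V" using N_subset x by blast
  have vx: "v \<in> N x" using x N_sym by blast
  have xv: "x \<noteq> v" using diff by auto
  have xU: "x \<notin> U"
  proof
    assume xU: "x \<in> U"
    \<comment> \<open>Applied to both \<open>x\<close> and \<open>v\<close>, this would give them
      equal white neighbourhoods.\<close>
    have "N c \<inter> U = {x,v}" if "x \<in> N c" "v \<in> N c" "c \<in> U" for c
    proof -
      have "finite (N c \<inter> U)" "{x,v} \<subseteq> N c \<inter> U" using finite_U[OF U] that xU v by auto
      then show ?thesis using card_seteq[of "N c \<inter> U" "{x,v}"] degU[OF that(3)] xv by simp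
    qed
    then show False using diff x vx xU v N_refl by blast
  qed
  note edge = dominate_white_edge[OF U _ _ _ _ _ xU _ deg degU]
  show ?thesis
  proof (cases "N v \<inter> U \<subseteq> {v}")
    case False
    then show ?thesis using edge[of v] v x diff by blast
  next
    case True
    then have Nv: "N v \<inter> U = {v}" using v N_refl by blast
    have dv: "15 \<le> drop_at U x v" using drop_white1[OF U v vx, of 0] Nv by simp
    have "\<not> N x \<inter> U \<subseteq> {v}" using diff Nv vx v by auto
    then obtain y where y: "y \<in> N x" "y \<in> U" "y \<noteq> v" by blast
    have xy: "x \<in> N y" using y N_sym by blast
    have drop9: "9 \<le> drop_at U x a" if "a \<in> N x" "a \<in> U" for a
      using drop_white1[OF U that(2,1), of 1] degU[OF that(2)] by simp
    show ?thesis
    \<comment> \<open>With a third white neighbour \<open>a\<close>, playing \<open>x\<close> gains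
      at least 8 + 15 + 9 + 9.\<close>
    proof (cases "N x \<inter> U \<subseteq> {v,y}")
      case False
      then obtain a where a: "a \<in> N x" "a \<in> U" "a \<noteq> v" "a \<noteq> y" by blast
      have "card (N x \<inter> U) = 3"
        using card_ge[OF U, of "[v,y,a]" x] deg[OF xV] v y a vx by auto
      moreover have "x \<noteq> y" "x \<noteq> a" using xU y a by auto
      ultimately have "38 \<le> gain U x"
        using sum_list_drop_le_gain[of U "[x,v,y,a]" x] U xV xv v y a dv
          drop9[OF y(1,2)] drop9[OF a(1,2)] drop_self_blue[OF xU]
        by (simp add: subsetD[OF U])
      then show ?thesis using xV by blast
    next
      case two: True
      then have Nx: "N x \<inter> U = {v,y}" using v y vx by blast
      show ?thesis
      proof (cases "N y \<inter> U \<subseteq> {y}")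
        case False
        then obtain u where "u \<in> N y" "u \<in> U" "u \<noteq> y" by blast
        moreover have "N x \<inter> U \<noteq> N y \<inter> U"
          using Nx Nv y N_sym[of v y] v by blast
        ultimately show ?thesis using edge[of y u] y xy by blast
      next
        case True
        then have "N y \<inter> U = {y}" using y N_refl by blast
        then have dy: "15 \<le> drop_at U x y" using drop_white1[OF U y(2,1), of 0] by simp
        \<comment> \<open>Both white neighbours of \<open>x\<close> are isolated among the white
          vertices: 15 + 15 + 7, and the blue common neighbour \<open>z\<close> of \<open>v\<close>
          and \<open>x\<close> adds the last 1.\<close>
        obtain z where z: "z \<in> V" "z \<noteq> x" "z \<noteq> v" "z \<in> N x" "z \<in> N v" "x \<in> N z" "v \<in> N z"
          using third[OF vV x xv] by blast
        have zU: "z \<notin> U" using z Nv by blast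
        have "1 \<le> drop_at U x z"
          using drop_blue1[OF U zU deg[OF z(1)], of v x] z v vx by auto
        moreover have "drop_at U x x = 7"
          using drop_self_blue[OF xU] Nx y(3) by (simp add: numeral_2_eq_2[symmetric])
        moreover have "x \<noteq> y" "z \<noteq> y" using xU zU y by auto
        ultimately have "38 \<le> gain U x"
          using sum_list_drop_le_gain[of U "[x,v,y,z]" x] U xV xv v y z dv dy
          by (simp add: subsetD[OF U])
        then show ?thesis using xV by blast
      qed
    qed
  qed
qed

text \<open>The bound 27 covers the case that Dominator's move ends the game, the bound 54 a move
  followed by any legal reply.\<close>

lemma exists_good_move:
  assumes U: "U \<subseteq> V" "U \<noteq> {}"
  shows "\<exists>v\<in>V. 27 \<le> gain U v \<and>
    (\<forall>w\<in>V. N w \<inter> (U - N v) \<noteq> {} \<longrightarrow> 54 \<le> gain U v + gain (U - N v) w)"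
proof -
  have sub: "U - N v \<subseteq> V" for v using U by auto
  \<comment> \<open>Degrees only shrink, so the degree bounds of a phase still hold when Staller
    replies.\<close>
  have card_Diff: "card (N x \<inter> (U - N v)) \<le> card (N x \<inter> U)" for x v
    using finite_U[OF U(1)] by (intro card_mono) auto
  have good: ?thesis
    if "v \<in> V" "k \<le> gain U v" "27 \<le> k"
      "\<And>w u. \<lbrakk>w \<in> V; u \<in> N w; u \<in> U - N v\<rbrakk> \<Longrightarrow> 54 - k \<le> gain (U - N v) w" for v k
    using that by (intro bexI[of _ v]) fastforce+
  consider (five) v where "v \<in> V" "5 \<le> card (N v \<inter> U)"
    | (four) "\<And>x. x \<in> V \<Longrightarrow> card (N x \<inter> U) \<le> 4"
    by force
  then show ?thesis
  proof cases
    case five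
    show ?thesis
      using good[OF five(1) dominate_five[OF U(1) five]] move_ge_13[OF sub] by fastforce
  next
    case four
    show ?thesis
    proof (cases "\<forall>x\<in>U. card (N x \<inter> U) \<le> 3")
      case False
      then obtain v where v: "v \<in> U" "card (N v \<inter> U) = 4" using four U by force
      then show ?thesis
        using good[OF _ dominate_white_four[OF U(1) v four]] move_ge_13[OF sub] U by fastforce
    next
      case True
      have S14: "14 \<le> gain (U - N v) w" if "w \<in> V" "u \<in> N w" "u \<in> U - N v" for u v w
        using move_ge_14[OF sub that] True card_Diff le_trans by blast
      show ?thesis
      proof (cases "\<exists>v\<in>V. card (N v \<inter> U) = 4")
        case True': True
        then obtain v where v: "v \<in> V" "v \<notin> U" "card (N v \<inter> U) = 4" using True by force
        show ?thesis
          using good[OF v(1) dominate_blue_four[OF U(1) v]] True S14 by fastforce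
      next
        case False
        then have deg: "card (N x \<inter> U) \<le> 3" if "x \<in> V" for x using four that by force
        then have deg': "card (N x \<inter> (U - N v)) \<le> 3" if "x \<in> V" for x v
          using that card_Diff le_trans by blast
        show ?thesis
        proof (cases "\<exists>x\<in>U. \<exists>y\<in>U. \<exists>z\<in>U. x \<noteq> y \<and> y \<noteq> z \<and> x \<noteq> z \<and> x \<in> N y \<and> y \<in> N z \<and> x \<in> N z")
          case tri: True
          then obtain x y z where xyz: "x \<in> U" "y \<in> U" "z \<in> U" "x \<noteq> y" "y \<noteq> z" "x \<noteq> z"
              "x \<in> N y" "y \<in> N z" "x \<in> N z" by blast
          have "45 \<le> gain U x" using dominate_white_triangle[OF U(1) _ xyz] True by blast
          then show ?thesis using good[of x 45] S14 xyz(1) U by fastforce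
        next
          case notri: False
          have S15: "15 \<le> gain (U - N v) w" if "w \<in> V" "u \<in> N w" "u \<in> U - N v" for u v w
            using move_ge_15[OF sub that deg'] notri by blast
          show ?thesis
          proof (cases "\<exists>v\<in>U. card (N v \<inter> U) = 3")
            case True
            then obtain v where "v \<in> U" "card (N v \<inter> U) = 3" by blast
            from dominate_white_path[OF U(1) this deg] notri
            obtain v where "v \<in> V" "39 \<le> gain U v" by blast
            then show ?thesis using good[of v 39] S15 by fastforce
          next
            case False
            then have degU: "card (N x \<inter> U) \<le> 2" if "x \<in> U" for x
              using deg[of x] U that by force
            show ?thesis
            proof (cases "safe U")
              case safe: True
              obtain v where v: "v \<in> U" using U by blast
              have "27 \<le> gain U v" using safe_move[OF U(1) _ N_refl v safe] v U by blast
              then show ?thesis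
                using good[of v 27] safe_move[OF sub _ _ _ safe_Diff[OF safe]] v U by fastforce
            next
              case unsafe: False
              obtain v where v: "v \<in> V" "38 \<le> gain U v"
                using dominate_unsafe[OF U(1) unsafe deg degU] by blast
              have "16 \<le> gain (U - N v) w" if "w \<in> V" "u \<in> N w" "u \<in> U - N v" for u w
                using move_ge_16[OF sub that deg'] degU card_Diff le_trans by blast
              then show ?thesis using good[OF v] by fastforce
            qed
          qed
        qed
      qed
    qed
  qed
qed

section \<open>From the potential to the value of the game\<close>

lemma potential_nonneg: "0 \<le> potential U"
  by (simp add: potential_def weight_def beta_nonneg sum_nonneg)

lemma potential_V: "potential V = 15 * int (card V)"
  by (simp add: potential_def weight_def)

end

text \<open>Strong induction on the fuel, two moves at a time, always with Dominator to move. Any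
  fuel is allowed: exhausted fuel gives value 0, and the potential is nonnegative.\<close>

lemma (in triangle_nbhd) dgame_bound:
  assumes N: "N = closed_nbhd E"
  shows "27 * int (dgame V E f S True) \<le> potential (V - S)"
proof (induction f arbitrary: S rule: less_induct)
  case (less f)
  show ?case
  proof (cases "f = 0 \<or> V \<subseteq> S")
    case True
    then have "dgame V E f S True = 0" by (cases f) auto
    then show ?thesis using potential_nonneg[of "V - S"] by simp
  next
    case False
    then obtain g where f: "f = Suc g" by (cases f) auto
    have ne: "V - S \<noteq> {}" using False by blast
    obtain v where v: "v \<in> V" "27 \<le> gain (V - S) v"
      and reply: "\<And>w. w \<in> V \<Longrightarrow> N w \<inter> (V - S - N v) \<noteq> {} \<Longrightarrow>
        54 \<le> gain (V - S) v + gain (V - S - N v) w"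
      using exists_good_move[OF Diff_subset ne] by auto
    define T where "T = S \<union> N v"
    have VT: "V - S - N v = V - T" by (auto simp: T_def)
    have gain_v: "gain (V - S) v = potential (V - S) - potential (V - T)"
      by (simp add: gain_def VT)
    \<comment> \<open>An illegal move would leave the position unchanged and gain 0.\<close>
    have legal: "\<not> N v \<subseteq> S"
    proof
      assume "N v \<subseteq> S"
      then have "T = S" by (auto simp: T_def)
      then show False using v gain_v by simp
    qed
    let ?R = "(\<lambda>v. dgame V E g (S \<union> N v) False) ` {v \<in> V. \<not> N v \<subseteq> S}"
    have "Min ?R \<le> dgame V E g T False"
      using finite_V v legal by (intro Min_le) (auto simp: T_def)
    then have le: "dgame V E f S True \<le> 1 + dgame V E g T False"
      using False by (simp add: f N)
    show ?thesis
    proof (cases "g = 0 \<or> V \<subseteq> T")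
      case True
      then have "dgame V E g T False = 0" by (cases g) auto
      then show ?thesis using le v gain_v potential_nonneg[of "V - T"] by simp
    next
      case False
      then obtain h where g: "g = Suc h" by (cases g) auto
      let ?W = "{w \<in> V. \<not> N w \<subseteq> T}"
      let ?Q = "(\<lambda>w. dgame V E h (T \<union> N w) True) ` ?W"
      \<comment> \<open>Any undominated vertex is itself a legal reply, so the maximum is attained
        at some \<open>w\<close>.\<close>
      have "?W \<noteq> {}" using False N_refl by blast
      then have "Max ?Q \<in> ?Q" using finite_V by (intro Max_in) auto
      then obtain w where w: "w \<in> V" "\<not> N w \<subseteq> T" "Max ?Q = dgame V E h (T \<union> N w) True"
        by blast
      have "dgame V E g T False = 1 + dgame V E h (T \<union> N w) True"
        using False w(3) by (simp add: g N)
      moreover have "27 * int (dgame V E h (T \<union> N w) True) \<le> potential (V - (T \<union> N w))"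
        using less.IH[of h] f g by simp
      moreover have "54 \<le> gain (V - S) v + gain (V - T) w"
        using reply[OF w(1)] w(2) N_subset[OF w(1)] VT by auto
      moreover have "V - T - N w = V - (T \<union> N w)" by auto
      ultimately show ?thesis using le gain_v by (simp add: gain_def)
    qed
  qed
qed

section \<open>Application to hypergraphs and graphs\<close>

lemma game_domination_number_le:
  assumes "hypergraph V E" "no_isolated V E"
    and common: "\<And>u v. adjacent E u v \<Longrightarrow> \<exists>w. adjacent E u w \<and> adjacent E v w"
  shows "real (game_domination_number V E) \<le> 5 / 9 * real (card V)"
proof -
  have adj_sym: "adjacent E u v \<longleftrightarrow> adjacent E v u" for u v
    by (auto simp: adjacent_def)
  interpret triangle_nbhd V "closed_nbhd E"
  proof
    show "finite V" using assms(1) by (simp add: hypergraph_def)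
    show "closed_nbhd E v \<subseteq> V" if "v \<in> V" for v
      using assms(1) that by (auto simp: hypergraph_def closed_nbhd_def adjacent_def)
    show "v \<in> closed_nbhd E v" for v by (simp add: closed_nbhd_def)
    show "v \<in> closed_nbhd E u" if "u \<in> closed_nbhd E v" for u v
      using that adj_sym by (auto simp: closed_nbhd_def)
    show "\<exists>w. w \<noteq> u \<and> w \<noteq> v \<and> w \<in> closed_nbhd E u \<and> w \<in> closed_nbhd E v"
      if uv: "u \<in> closed_nbhd E v" "u \<noteq> v" for u v
    proof -
      obtain w where "adjacent E v w" "adjacent E u w"
        using common[of v u] uv unfolding closed_nbhd_def by blast
      then show ?thesis by (auto simp: closed_nbhd_def adjacent_def)
    qed
    show "\<exists>u. u \<in> closed_nbhd E v \<and> u \<noteq> v" if "v \<in> V" for v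
      using assms(2) that by (auto simp: no_isolated_def closed_nbhd_def adjacent_def)
  qed
  \<comment> \<open>The initial potential is 15 per vertex, and 15 / 27 = 5 / 9.\<close>
  have "27 * int (game_domination_number V E) \<le> 15 * int (card V)"
    using dgame_bound[OF refl, of "card V" "{}"] potential_V
    by (simp add: game_domination_number_def)
  then show ?thesis by linarith
qed

text \<open>The third vertex of an edge through \<open>u\<close> and \<open>v\<close> is adjacent to
  both.\<close>

lemma uniform_3_third:
  assumes "uniform 3 E" "adjacent E u v"
  shows "\<exists>w. adjacent E u w \<and> adjacent E v w"
proof -
  obtain e where e: "u \<noteq> v" "e \<in> E" "u \<in> e" "v \<in> e" using assms(2) by (auto simp: adjacent_def)
  then have "card e = 3" using assms(1) by (simp add: uniform_def)
  then have "\<not> e \<subseteq> {u,v}" using card_mono[of "{u,v}" e] e(1) by auto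
  then show ?thesis using e by (auto simp: adjacent_def)
qed

text \<open>Distinct vertices of \<open>{a,b}\<close> are \<open>a\<close> and \<open>b\<close> in
  some order, so the apex of the triangle on this edge serves.\<close>

lemma every_edge_in_triangle_third:
  assumes "uniform 2 E" "every_edge_in_triangle E" "adjacent E u v"
  shows "\<exists>w. adjacent E u w \<and> adjacent E v w"
proof -
  obtain e where e: "u \<noteq> v" "e \<in> E" "u \<in> e" "v \<in> e" using assms(3) by (auto simp: adjacent_def)
  obtain a b w where abw: "e = {a,b}" "{a,w} \<in> E" "{b,w} \<in> E" "w \<noteq> a" "w \<noteq> b"
    using assms(2) e(2) unfolding every_edge_in_triangle_def by metis
  have "u \<noteq> w \<and> {u,w} \<in> E \<and> v \<noteq> w \<and> {v,w} \<in> E" using e abw by auto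
  then have "adjacent E u w \<and> adjacent E v w" unfolding adjacent_def by blast
  then show ?thesis by blast
qed

theorem theorem3:
  shows "(\<forall>(V :: 'a set) E. hypergraph V E \<and> uniform 3 E \<and> no_isolated V E \<longrightarrow>
            real (game_domination_number V E) \<le> 5 / 9 * real (card V))
       \<and> (\<forall>(V :: 'a set) E. simple_graph V E \<and> no_isolated V E \<and> every_edge_in_triangle E \<longrightarrow>
            real (game_domination_number V E) \<le> 5 / 9 * real (card V))"
  using game_domination_number_le uniform_3_third every_edge_in_triangle_third
  unfolding simple_graph_def by metis

end
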